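(* Let $w_*\in\mathbb{R}_+^d$ and $f(u)=\frac14\|u^{\odot2}-w_*\|^2$ for $u\in\mathbb{R}^d$. Then $f$ is twice differentiable. It is $L$-smooth with $L=3R^2$ and has $L_H$-Lipschitz Hessian with $L_H=6R$ in the ball $\{u:\|u\|_\infty\le R\}$, for any finite $R>0$. Furthermore, $f$ is $\mu$-PL at $u$ with $\mu=2\min_{i\in[d]}(u_i)^2$, and for $\hat u\in\mathcal{U}:=\{\hat u\in\mathbb{R}^d:\hat u_i=\pm\sqrt{w_{*,i}}\}$ the average Hessian $H_f(u)$ between $u$ and $\hat u$ satisfies $$\lambda_{\min}(H_f(u))=\min_{i\in[d]}\left((u_i)^2+u_i\hat u_i\right).$$
   Context: $u^{\odot2}\in\mathbb{R}^d$ is the vector with entries $(u_i)^2$. The set $\mathcal{U}$ is the set of global minimizers of $f$. The average Hessian between $u$ and $\hat u$ is $H_f(u):=\int_0^1\nabla^2f(\theta u+(1-\theta)\hat u)\,d\theta$. $f$ is $\mu$-PL (Polyak-Łojasiewicz) at $u$ if $\|\nabla f(u)\|^2\ge2\mu(f(u)-\min f)$. $L$-smooth means Lipschitz gradient with constant $L$ and $L_H$-Lipschitz Hessian means $\|\nabla^2f(x)-\nabla^2f(y)\|_2\le L_H\|x-y\|_2$, here for $x,y$ in the stated ball.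
   Formalization: The claim that f is L-smooth with L=3R^2 in the ball is stated only when all w_{*,i} ≤ 3R^2, as it fails otherwise (d=1, w_*=100, R=1); for every R>0 the quadratic upper bound with L=3R^2 is given instead. *)

theory Defs
  imports "HOL-Analysis.Analysis"
begin

definition gradient :: "('a::real_inner \<Rightarrow> real) \<Rightarrow> 'a \<Rightarrow> 'a" where
  "gradient f x = (THE g. GDERIV f x :> g)"

definition hessian :: "(real ^ 'n \<Rightarrow> real) \<Rightarrow> real ^ 'n \<Rightarrow> real ^ 'n ^ 'n" where
  "hessian f x = jacobian (gradient f) (at x)"

definition twice_differentiable :: "(real ^ 'n \<Rightarrow> real) \<Rightarrow> bool" where
  "twice_differentiable f \<longleftrightarrow>
     (\<forall>x. f differentiable (at x)) \<and> (\<forall>x. gradient f differentiable (at x))"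

(* The library norm on real ^ 'n ^ 'n is the Frobenius norm, hence the operator norm here. *)
definition spectral_norm :: "real ^ 'n ^ 'n \<Rightarrow> real" where
  "spectral_norm A = onorm ((*v) A)"

definition L_smooth_on :: "real \<Rightarrow> (real ^ 'n) set \<Rightarrow> (real ^ 'n \<Rightarrow> real) \<Rightarrow> bool" where
  "L_smooth_on L S f \<longleftrightarrow> L-lipschitz_on S (gradient f)"

definition lipschitz_hessian_on ::
    "real \<Rightarrow> (real ^ 'n) set \<Rightarrow> (real ^ 'n \<Rightarrow> real) \<Rightarrow> bool" where
  "lipschitz_hessian_on L S f \<longleftrightarrow>
     (\<forall>x\<in>S. \<forall>y\<in>S. spectral_norm (hessian f x - hessian f y) \<le> L * norm (x - y))"

definition global_minimizers :: "('a \<Rightarrow> real) \<Rightarrow> 'a set" where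
  "global_minimizers f = {x. \<forall>y. f x \<le> f y}"

(* Meant for f that attains its minimum, where the infimum is min f; \<mu> = 0 is allowed. *)
definition PL_at :: "real \<Rightarrow> (real ^ 'n \<Rightarrow> real) \<Rightarrow> real ^ 'n \<Rightarrow> bool" where
  "PL_at \<mu> f u \<longleftrightarrow> (norm (gradient f u))\<^sup>2 \<ge> 2 * \<mu> * (f u - (INF v. f v))"

definition average_hessian ::
    "(real ^ 'n \<Rightarrow> real) \<Rightarrow> real ^ 'n \<Rightarrow> real ^ 'n \<Rightarrow> real ^ 'n ^ 'n" where
  "average_hessian f uh u =
     integral {0..1} (\<lambda>\<theta>. hessian f (\<theta> *\<^sub>R u + (1 - \<theta>) *\<^sub>R uh))"

definition eigenvalues :: "real ^ 'n ^ 'n \<Rightarrow> real set" where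
  "eigenvalues A = {c. \<exists>v. v \<noteq> 0 \<and> A *v v = c *\<^sub>R v}"

(* Meant for symmetric A, whose set of real eigenvalues is finite and nonempty. *)
definition lambda_min :: "real ^ 'n ^ 'n \<Rightarrow> real" where
  "lambda_min A = Min (eigenvalues A)"

definition hadamard_square :: "real ^ 'n \<Rightarrow> real ^ 'n" where
  "hadamard_square u = (\<chi> i. (u $ i)\<^sup>2)"

definition loss :: "real ^ 'n \<Rightarrow> real ^ 'n \<Rightarrow> real" where
  "loss w u = 1 / 4 * (norm (hadamard_square u - w))\<^sup>2"

end

theory Submission
  imports Defs
begin

text \<open>
  The loss is separable: it is the sum over the coordinates of the quartic
  \<open>q a w = (a\<^sup>2 - w)\<^sup>2 / 4\<close>, with \<open>q' = (a\<^sup>2 - w) * a\<close> and \<open>q'' = 3 * a\<^sup>2 - w\<close>.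
  Hence the gradient acts coordinatewise and the Hessian at \<open>u\<close> is the diagonal matrix with
  entries \<open>3 * (u $ i)\<^sup>2 - w $ i\<close>, so that every claim becomes a claim about scalars.

  On the ball of radius \<open>R\<close>, divided differences give the constants: the gradient has the factor
  \<open>a\<^sup>2 + a * b + b\<^sup>2 - w\<close>, of absolute value at most \<open>3 * R\<^sup>2\<close> once \<open>0 \<le> w \<le> 3 * R\<^sup>2\<close>;
  the second-order remainder has the factor \<open>3/4 * a\<^sup>2 + a * b / 2 + b\<^sup>2 / 4 - w / 2\<close>, bounded
  above by \<open>3/2 * R\<^sup>2\<close> for every \<open>w \<ge> 0\<close>; and the Hessian has \<open>3 * (a + b)\<close>.  The PL
  inequality compares \<open>\<Sum>i. (u $ i)\<^sup>2 * ((u $ i)\<^sup>2 - w $ i)\<^sup>2\<close> with the same sum in which the weights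
  \<open>(u $ i)\<^sup>2\<close> are replaced by their minimum; the infimum of the loss is \<open>0\<close> because \<open>w\<close> has a
  coordinatewise square root.

  Along the segment from \<open>uh\<close> to \<open>u\<close> the Hessian is a matrix polynomial of degree two, whose
  integral is diagonal with entries \<open>u\<^sup>2 + u * uh + uh\<^sup>2 - w\<close>.  At a minimizer \<open>uh\<^sup>2 = w\<close>, which leaves
  \<open>u\<^sup>2 + u * uh\<close>; these entries are the eigenvalues.
\<close>

section \<open>Diagonal matrices\<close>

definition diagonal_matrix :: "real ^ 'n \<Rightarrow> real ^ 'n ^ 'n" where
  "diagonal_matrix d = (\<chi> i j. if i = j then d $ i else 0)"

lemma diagonal_matrix_mult_vector: "diagonal_matrix d *v v = (\<chi> i. d $ i * v $ i)"
  by (simp add: diagonal_matrix_def matrix_vector_mult_def if_distrib if_distribR cong: if_cong)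

text \<open>
  Lipschitz bounds for coordinatewise maps reduce to bounds for scalars, with no dependence of the
  constant on the dimension.
\<close>

lemma norm_le_mult_componentwise:
  fixes x y :: "real ^ 'n"
  assumes "0 \<le> L" and "\<And>i. \<bar>x $ i\<bar> \<le> L * \<bar>y $ i\<bar>"
  shows "norm x \<le> L * norm y"
proof -
  have "norm x \<le> norm (L *\<^sub>R y)"
    by (rule norm_le_componentwise_cart) (use assms in \<open>simp add: abs_mult\<close>)
  then show ?thesis using assms(1) by simp
qed

lemma spectral_norm_diagonal_matrix_le:
  assumes "0 \<le> L" and "\<And>i. \<bar>d $ i\<bar> \<le> L"
  shows "spectral_norm (diagonal_matrix d) \<le> L"
  unfolding spectral_norm_def
proof (rule onorm_le)
  fix v
  show "norm (diagonal_matrix d *v v) \<le> L * norm v"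
    by (rule norm_le_mult_componentwise)
       (use assms in \<open>auto simp: diagonal_matrix_mult_vector abs_mult intro: mult_right_mono\<close>)
qed

text \<open>
  An eigenvector has some nonzero coordinate \<open>i\<close>, and there the eigenvalue must be \<open>d $ i\<close>;
  conversely the unit vector \<open>axis i 1\<close> is an eigenvector for \<open>d $ i\<close>.
\<close>

lemma eigenvalues_diagonal_matrix: "eigenvalues (diagonal_matrix d) = range (($) d)"
proof (intro set_eqI iffI)
  fix c assume "c \<in> eigenvalues (diagonal_matrix d)"
  then obtain v where "v \<noteq> 0" and v: "\<And>i. d $ i * v $ i = c * v $ i"
    by (auto simp: eigenvalues_def diagonal_matrix_mult_vector vec_eq_iff)
  then obtain i where "v $ i \<noteq> 0" by (auto simp: vec_eq_iff)
  then show "c \<in> range (($) d)" using v[of i] by auto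
next
  fix c assume "c \<in> range (($) d)"
  then obtain i where "c = d $ i" by auto
  then have "diagonal_matrix d *v axis i 1 = c *\<^sub>R axis i 1"
    by (auto simp: diagonal_matrix_mult_vector vec_eq_iff axis_def)
  moreover have "axis i (1::real) \<noteq> 0" by (simp add: axis_eq_0_iff)
  ultimately show "c \<in> eigenvalues (diagonal_matrix d)"
    unfolding eigenvalues_def by blast
qed

lemma lambda_min_diagonal_matrix: "lambda_min (diagonal_matrix d) = (MIN i. d $ i)"
  by (simp add: lambda_min_def eigenvalues_diagonal_matrix)

section \<open>Derivatives of the loss\<close>

text \<open>
  The gradient is a definite description, so this rests on uniqueness: the functional
  \<open>\<lambda>h. h \<bullet> g\<close> determines \<open>g\<close>.
\<close>

lemma gradient_eqI:
  assumes "GDERIV f x :> g"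
  shows "gradient f x = g"
  unfolding gradient_def
proof (rule the_equality)
  show "GDERIV f x :> g" by (rule assms)
  fix g' assume "GDERIV f x :> g'"
  with assms have "(\<lambda>h. h \<bullet> g') = (\<lambda>h. h \<bullet> g)"
    unfolding gderiv_def by (metis has_derivative_unique)
  then show "g' = g" by (metis vector_eq_ldot)
qed

lemma has_derivative_matrix_imp_jacobian_eq:
  fixes f :: "real ^ 'n \<Rightarrow> real ^ 'm"
  assumes "(f has_derivative (*v) A) (at x)"
  shows "jacobian f (at x) = A"
  using frechet_derivative_at[OF assms, symmetric]
  by (simp add: jacobian_def matrix_of_matrix_vector_mul)

lemma loss_eq_sum: "loss w u = (\<Sum>i\<in>UNIV. 1 / 4 * ((u $ i)\<^sup>2 - w $ i)\<^sup>2)"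
  unfolding loss_def hadamard_square_def power2_norm_eq_inner inner_vec_def
  by (simp add: power2_eq_square sum_distrib_left)

lemma has_derivative_vec_nth: "((\<lambda>x. x $ i) has_derivative (\<lambda>h. h $ i)) (at u)"
  by (rule bounded_linear_imp_has_derivative[OF bounded_linear_vec_nth])

lemma GDERIV_loss: "GDERIV (loss w) u :> (\<chi> i. ((u $ i)\<^sup>2 - w $ i) * u $ i)"
proof -
  have "((\<lambda>x. 1 / 4 * ((x $ i)\<^sup>2 - w $ i)\<^sup>2) has_derivative
      (\<lambda>h. h $ i \<bullet> (((u $ i)\<^sup>2 - w $ i) * u $ i))) (at u)" for i
    by (auto intro!: derivative_eq_intros has_derivative_vec_nth
        simp: fun_eq_iff power2_eq_square algebra_simps)
  then show ?thesis
    unfolding gderiv_def loss_eq_sum[abs_def] inner_vec_def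
    by (simp add: has_derivative_sum del: inner_real_def)
qed

lemma gradient_loss: "gradient (loss w) u = (\<chi> i. ((u $ i)\<^sup>2 - w $ i) * u $ i)"
  by (rule gradient_eqI[OF GDERIV_loss])

lemma has_derivative_gradient_loss:
  "(gradient (loss w) has_derivative (*v) (diagonal_matrix (\<chi> i. 3 * (u $ i)\<^sup>2 - w $ i))) (at u)"
  unfolding gradient_loss[abs_def] diagonal_matrix_mult_vector[abs_def]
proof (rule has_derivative_componentwise_within[THEN iffD2], rule ballI)
  fix b :: "real ^ 'a" assume "b \<in> Basis"
  then obtain i where b: "b = axis i 1" by (auto simp: Basis_vec_def)
  have "((\<lambda>x. ((x $ i)\<^sup>2 - w $ i) * x $ i) has_derivative (\<lambda>h. (3 * (u $ i)\<^sup>2 - w $ i) * h $ i)) (at u)"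
    by (auto intro!: derivative_eq_intros has_derivative_vec_nth
        simp: fun_eq_iff power2_eq_square algebra_simps)
  then show "((\<lambda>x. (\<chi> i. ((x $ i)\<^sup>2 - w $ i) * x $ i) \<bullet> b) has_derivative
      (\<lambda>h. (\<chi> i. (\<chi> i. 3 * (u $ i)\<^sup>2 - w $ i) $ i * h $ i) \<bullet> b)) (at u)"
    by (simp add: b inner_axis)
qed

lemma hessian_loss: "hessian (loss w) u = diagonal_matrix (\<chi> i. 3 * (u $ i)\<^sup>2 - w $ i)"
  unfolding hessian_def
  by (rule has_derivative_matrix_imp_jacobian_eq[OF has_derivative_gradient_loss])

lemma twice_differentiable_loss: "twice_differentiable (loss w)"
  using GDERIV_loss has_derivative_gradient_loss
  unfolding twice_differentiable_def gderiv_def differentiable_def by blast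

section \<open>Smoothness on a box\<close>

lemma abs_component_le_if_infnorm_le:
  fixes u :: "real ^ 'n"
  assumes "infnorm u \<le> R"
  shows "\<bar>u $ i\<bar> \<le> R"
  using component_le_infnorm_cart[of u i] assms by linarith

text \<open>
  The scalar estimates behind the first two smoothness results.  The form \<open>a\<^sup>2 + a * b + b\<^sup>2\<close> is
  \<open>(a ^ 3 - b ^ 3) / (a - b)\<close>, hence nonnegative because cubing is increasing.
\<close>

lemma sum_squares_mixed_bounds:
  fixes a b R :: real
  assumes "\<bar>a\<bar> \<le> R" "\<bar>b\<bar> \<le> R"
  shows "0 \<le> a\<^sup>2 + a * b + b\<^sup>2" and "a\<^sup>2 \<le> R\<^sup>2" and "b\<^sup>2 \<le> R\<^sup>2" and "a * b \<le> R\<^sup>2"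
proof -
  have "a\<^sup>2 + a * b + b\<^sup>2 = ((a + b)\<^sup>2 + a\<^sup>2 + b\<^sup>2) / 2" by (simp add: power2_eq_square algebra_simps)
  moreover have "0 \<le> ((a + b)\<^sup>2 + a\<^sup>2 + b\<^sup>2) / 2" by simp
  ultimately show "0 \<le> a\<^sup>2 + a * b + b\<^sup>2" by (simp only:)
  have "0 \<le> R" using assms by linarith
  with assms show a: "a\<^sup>2 \<le> R\<^sup>2" and b: "b\<^sup>2 \<le> R\<^sup>2"
    by (simp_all add: power2_le_iff_abs_le)
  have "0 \<le> (a - b)\<^sup>2" by simp
  then show "a * b \<le> R\<^sup>2" using a b by (simp add: power2_diff)
qed

text \<open>
  The factor \<open>a\<^sup>2 + a * b + b\<^sup>2 - w\<close> ranges over \<open>{- w..3 * R\<^sup>2 - w}\<close>; the upper bound on \<open>w\<close>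
  keeps the lower end from falling below \<open>- 3 * R\<^sup>2\<close>.
\<close>

lemma L_smooth_on_loss:
  assumes w: "\<And>i. 0 \<le> w $ i" "\<And>i. w $ i \<le> 3 * R\<^sup>2"
  shows "L_smooth_on (3 * R\<^sup>2) {u. infnorm u \<le> R} (loss w)"
  unfolding L_smooth_on_def
proof (rule lipschitz_onI)
  fix x y :: "real ^ 'a" assume "x \<in> {u. infnorm u \<le> R}" "y \<in> {u. infnorm u \<le> R}"
  then have xy: "\<bar>x $ i\<bar> \<le> R" "\<bar>y $ i\<bar> \<le> R" for i
    by (auto intro: abs_component_le_if_infnorm_le)
  show "dist (gradient (loss w) x) (gradient (loss w) y) \<le> 3 * R\<^sup>2 * dist x y"
    unfolding dist_norm
  proof (rule norm_le_mult_componentwise)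
    fix i
    let ?s = "(x $ i)\<^sup>2 + x $ i * y $ i + (y $ i)\<^sup>2 - w $ i"
    have "(gradient (loss w) x - gradient (loss w) y) $ i = ?s * (x - y) $ i"
      by (simp add: gradient_loss power2_eq_square algebra_simps)
    moreover have "\<bar>?s\<bar> \<le> 3 * R\<^sup>2"
      using sum_squares_mixed_bounds[OF xy[of i]] w[of i] by linarith
    ultimately show "\<bar>(gradient (loss w) x - gradient (loss w) y) $ i\<bar> \<le> 3 * R\<^sup>2 * \<bar>(x - y) $ i\<bar>"
      by (simp add: abs_mult mult_right_mono)
  qed simp
qed simp

text \<open>
  The constant is the largest curvature: the Hessian entries satisfy \<open>3 * a\<^sup>2 - w \<le> 3 * R\<^sup>2\<close> because
  \<open>w \<ge> 0\<close>.  As the loss is a sum of quartics, this follows from exact scalar Taylor expansions.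
\<close>

lemma loss_quadratic_upper_bound:
  assumes w: "\<And>i. 0 \<le> w $ i" and x: "infnorm x \<le> R" and y: "infnorm y \<le> R"
  shows "loss w y \<le> loss w x + gradient (loss w) x \<bullet> (y - x) + 3 * R\<^sup>2 / 2 * (norm (y - x))\<^sup>2"
proof -
  have "1 / 4 * ((y $ i)\<^sup>2 - w $ i)\<^sup>2 \<le> 1 / 4 * ((x $ i)\<^sup>2 - w $ i)\<^sup>2
      + ((x $ i)\<^sup>2 - w $ i) * x $ i * (y $ i - x $ i) + 3 * R\<^sup>2 / 2 * (y $ i - x $ i)\<^sup>2" for i
  proof -
    let ?a = "x $ i" and ?b = "y $ i"
    \<comment> \<open>\<open>?r\<close> is the Taylor remainder of the quartic after the linear term, divided by \<open>(?b - ?a)\<^sup>2\<close>;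
      its nonnegative weights \<open>3 / 4\<close>, \<open>1 / 2\<close>, \<open>1 / 4\<close> add up to \<open>3 / 2\<close>.\<close>
    let ?r = "3 / 4 * ?a\<^sup>2 + ?a * ?b / 2 + ?b\<^sup>2 / 4 - w $ i / 2"
    have "1 / 4 * (?b\<^sup>2 - w $ i)\<^sup>2 = 1 / 4 * (?a\<^sup>2 - w $ i)\<^sup>2
        + (?a\<^sup>2 - w $ i) * ?a * (?b - ?a) + ?r * (?b - ?a)\<^sup>2"
      by (simp add: power2_eq_square field_simps)
    moreover have "?r \<le> 3 * R\<^sup>2 / 2"
      using sum_squares_mixed_bounds[OF x[THEN abs_component_le_if_infnorm_le, of i]
          y[THEN abs_component_le_if_infnorm_le, of i]] w[of i]
      by linarith
    then have "?r * (?b - ?a)\<^sup>2 \<le> 3 * R\<^sup>2 / 2 * (?b - ?a)\<^sup>2"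
      by (intro mult_right_mono) auto
    ultimately show ?thesis by linarith
  qed
  then have "(\<Sum>i\<in>UNIV. 1 / 4 * ((y $ i)\<^sup>2 - w $ i)\<^sup>2) \<le> (\<Sum>i\<in>UNIV. 1 / 4 * ((x $ i)\<^sup>2 - w $ i)\<^sup>2
      + ((x $ i)\<^sup>2 - w $ i) * x $ i * (y $ i - x $ i) + 3 * R\<^sup>2 / 2 * (y $ i - x $ i)\<^sup>2)"
    by (rule sum_mono)
  then show ?thesis
    unfolding loss_eq_sum gradient_loss power2_norm_eq_inner inner_vec_def
    by (simp add: sum.distrib sum_distrib_left power2_eq_square)
qed

lemma lipschitz_hessian_on_loss:
  assumes "0 \<le> R"
  shows "lipschitz_hessian_on (6 * R) {u. infnorm u \<le> R} (loss w)"
  unfolding lipschitz_hessian_on_def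
proof (intro ballI)
  fix x y :: "real ^ 'a" assume "x \<in> {u. infnorm u \<le> R}" "y \<in> {u. infnorm u \<le> R}"
  then have xy: "\<bar>x $ i\<bar> \<le> R" "\<bar>y $ i\<bar> \<le> R" for i
    by (auto intro: abs_component_le_if_infnorm_le)
  have eq: "hessian (loss w) x - hessian (loss w) y
      = diagonal_matrix (\<chi> i. 3 * (x $ i + y $ i) * (x - y) $ i)"
    by (simp add: hessian_loss diagonal_matrix_def vec_eq_iff power2_eq_square algebra_simps)
  have "\<bar>3 * (x $ i + y $ i) * (x - y) $ i\<bar> \<le> 6 * R * norm (x - y)" for i
  proof -
    have "\<bar>3 * (x $ i + y $ i)\<bar> \<le> 6 * R" using xy[of i] by (auto simp: abs_le_iff)
    then show ?thesis
      unfolding abs_mult[of "3 * (x $ i + y $ i)"]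
      by (intro mult_mono component_le_norm_cart) (use assms in auto)
  qed
  then show "spectral_norm (hessian (loss w) x - hessian (loss w) y) \<le> 6 * R * norm (x - y)"
    unfolding eq by (intro spectral_norm_diagonal_matrix_le) (use assms in auto)
qed

section \<open>Minimizers and the PL inequality\<close>

lemma loss_nonneg: "0 \<le> loss w u"
  by (simp add: loss_def)

lemma loss_eq_0_iff: "loss w u = 0 \<longleftrightarrow> (\<forall>i. (u $ i)\<^sup>2 = w $ i)"
  by (auto simp: loss_def hadamard_square_def vec_eq_iff)

lemma loss_sqrt_eq_0:
  assumes "\<And>i. 0 \<le> w $ i"
  shows "loss w (\<chi> i. sqrt (w $ i)) = 0"
  using assms by (simp add: loss_eq_0_iff)

lemma global_minimizers_loss_eq_zeros:
  assumes "\<And>i. 0 \<le> w $ i"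
  shows "global_minimizers (loss w) = {uh. \<forall>i. (uh $ i)\<^sup>2 = w $ i}"
  using loss_sqrt_eq_0[of w] loss_nonneg[of w] assms
  unfolding global_minimizers_def loss_eq_0_iff[symmetric]
  by (metis (mono_tags, lifting) order_antisym)

lemma INF_loss_eq_0:
  assumes "\<And>i. 0 \<le> w $ i"
  shows "(INF v. loss w v) = 0"
  by (rule cInf_eq_minimum) (use loss_sqrt_eq_0[of w] loss_nonneg assms in \<open>auto intro: range_eqI sym\<close>)

lemma PL_at_loss:
  assumes "\<And>i. 0 \<le> w $ i"
  shows "PL_at (2 * (MIN i. (u $ i)\<^sup>2)) (loss w) u"
proof -
  let ?m = "MIN i. (u $ i)\<^sup>2"
  have "(\<Sum>i\<in>UNIV. ?m * ((u $ i)\<^sup>2 - w $ i)\<^sup>2) \<le> (\<Sum>i\<in>UNIV. (u $ i)\<^sup>2 * ((u $ i)\<^sup>2 - w $ i)\<^sup>2)"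
    by (intro sum_mono mult_right_mono) auto
  also have "\<dots> = (norm (gradient (loss w) u))\<^sup>2"
    unfolding power2_norm_eq_inner inner_vec_def
    by (simp add: gradient_loss power2_eq_square mult_ac)
  also have "(\<Sum>i\<in>UNIV. ?m * ((u $ i)\<^sup>2 - w $ i)\<^sup>2) = 2 * (2 * ?m) * loss w u"
    by (simp add: loss_eq_sum sum_distrib_left)
  finally show ?thesis
    unfolding PL_at_def INF_loss_eq_0[OF assms] by simp
qed

section \<open>The average Hessian\<close>

text \<open>
  With \<open>x = uh + t * (u - uh)\<close> the entry \<open>3 * x\<^sup>2 - w\<close> is quadratic in \<open>t\<close>.  The scalar identity is
  that the mean of \<open>3 * x\<^sup>2\<close> over the segment is \<open>(u ^ 3 - uh ^ 3) / (u - uh)\<close>, written as a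
  polynomial so that \<open>u = uh\<close> needs no separate case.
\<close>

lemma average_hessian_loss:
  fixes u uh w :: "real ^ 'n"
  shows "average_hessian (loss w) uh u
    = diagonal_matrix (\<chi> i. (u $ i)\<^sup>2 + u $ i * uh $ i + (uh $ i)\<^sup>2 - w $ i)"
proof -
  \<comment> \<open>Matrix coefficients of \<open>t\<^sup>2\<close>, \<open>t\<close> and \<open>1\<close>; these are constant, so each power of \<open>t\<close> integrates
    as a scalar.\<close>
  define A where "A = diagonal_matrix (\<chi> i. 3 * (u $ i - uh $ i)\<^sup>2)"
  define B where "B = diagonal_matrix (\<chi> i. 6 * uh $ i * (u $ i - uh $ i))"
  define C where "C = diagonal_matrix (\<chi> i. 3 * (uh $ i)\<^sup>2 - w $ i)"
  have "hessian (loss w) (t *\<^sub>R u + (1 - t) *\<^sub>R uh) = t\<^sup>2 *\<^sub>R A + t *\<^sub>R B + C" for t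
    by (simp add: hessian_loss diagonal_matrix_def A_def B_def C_def vec_eq_iff
        power2_eq_square algebra_simps)
  moreover have "((\<lambda>t. t\<^sup>2 *\<^sub>R A + t *\<^sub>R B + C) has_integral
      ((1 ^ 3 / 3) *\<^sub>R A + (1\<^sup>2 / 2) *\<^sub>R B + 1 *\<^sub>R C)
        - ((0 ^ 3 / 3) *\<^sub>R A + (0\<^sup>2 / 2) *\<^sub>R B + 0 *\<^sub>R C)) {0..1::real}"
    by (rule fundamental_theorem_of_calculus)
       (auto intro!: derivative_eq_intros simp: power2_eq_square)
  ultimately have "average_hessian (loss w) uh u = (1 / 3) *\<^sub>R A + (1 / 2) *\<^sub>R B + C"
    by (simp add: average_hessian_def integral_unique)
  also have "\<dots> = diagonal_matrix (\<chi> i. (u $ i)\<^sup>2 + u $ i * uh $ i + (uh $ i)\<^sup>2 - w $ i)"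
    by (simp add: diagonal_matrix_def A_def B_def C_def vec_eq_iff power2_eq_square field_simps)
  finally show ?thesis .
qed

theorem lemma6:
  fixes w :: "real ^ 'd"
  assumes w_nonneg: "\<And>i. 0 \<le> w $ i"
  shows "twice_differentiable (loss w)
    \<and> (\<forall>R>0. (\<forall>i. w $ i \<le> 3 * R\<^sup>2) \<longrightarrow>
         L_smooth_on (3 * R\<^sup>2) {u. infnorm u \<le> R} (loss w))
    \<and> (\<forall>R>0. \<forall>x \<in> {u. infnorm u \<le> R}. \<forall>y \<in> {u. infnorm u \<le> R}.
         loss w y \<le> loss w x + gradient (loss w) x \<bullet> (y - x) + 3 * R\<^sup>2 / 2 * (norm (y - x))\<^sup>2)
    \<and> (\<forall>R>0. lipschitz_hessian_on (6 * R) {u. infnorm u \<le> R} (loss w))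
    \<and> (\<forall>u. PL_at (2 * (MIN i. (u $ i)\<^sup>2)) (loss w) u)
    \<and> global_minimizers (loss w) = {uh. \<forall>i. uh $ i = sqrt (w $ i) \<or> uh $ i = - sqrt (w $ i)}
    \<and> (\<forall>u. \<forall>uh \<in> global_minimizers (loss w).
         lambda_min (average_hessian (loss w) uh u) = (MIN i. (u $ i)\<^sup>2 + u $ i * uh $ i))"
proof (intro conjI allI impI ballI)
  have signed_root_iff: "a\<^sup>2 = w $ i \<longleftrightarrow> a = sqrt (w $ i) \<or> a = - sqrt (w $ i)" for a i
    using w_nonneg[of i] power2_eq_iff[of a "sqrt (w $ i)"] by simp
  show "global_minimizers (loss w) = {uh. \<forall>i. uh $ i = sqrt (w $ i) \<or> uh $ i = - sqrt (w $ i)}"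
    using global_minimizers_loss_eq_zeros[of w] w_nonneg by (simp add: signed_root_iff)
next
  fix u uh assume "uh \<in> global_minimizers (loss w)"
  then have "(uh $ i)\<^sup>2 = w $ i" for i
    using global_minimizers_loss_eq_zeros[of w] w_nonneg by simp
  then show "lambda_min (average_hessian (loss w) uh u) = (MIN i. (u $ i)\<^sup>2 + u $ i * uh $ i)"
    by (simp add: average_hessian_loss lambda_min_diagonal_matrix)
next
  fix R :: real and x y :: "real ^ 'd"
  assume "x \<in> {u. infnorm u \<le> R}" and "y \<in> {u. infnorm u \<le> R}"
  then show "loss w y \<le> loss w x + gradient (loss w) x \<bullet> (y - x) + 3 * R\<^sup>2 / 2 * (norm (y - x))\<^sup>2"
    using w_nonneg by (intro loss_quadratic_upper_bound) auto
qed (use w_nonneg in \<open>auto intro!: twice_differentiable_loss L_smooth_on_loss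
       lipschitz_hessian_on_loss PL_at_loss\<close>)

end
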